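(* Let $k\in\mathbb{N}_0$, $n\in\mathbb{N}$, $0<p<1$, $k\le pn$, and put $f=k/n$. Then $$1\le L(n,k,p)\le \frac{B_{n,k}(p)}{b_{n,k}(p)}\le U(n,k,p)<2L(n,k,p),$$ where all inequalities are strict when $k\ge 1$. If in addition $0<f<p$, then $$1<L(n,k,p)<\frac{B_{n,k}(p)}{b_{n,k}(p)}<U(n,k,p)\le V(n,k,p,0)<\frac{(1-f)p}{p-f}=\frac{1}{1-r}.$$
   Context: $\mathbb{N}$ denotes the positive integers and $\mathbb{N}_0$ the nonnegative integers. Throughout $q=1-p$. For integers $0\le k\le n$, $$b_{n,k}(p)=\binom{n}{k}p^kq^{n-k},\qquad B_{n,k}(p)=\sum_{j=0}^k b_{n,j}(p).$$ For $n\ge 0$, $0<p<1$, $0\le k\le pn$ define $$L(n,k,p)=\frac{k+1-pn+\sqrt{(pn-k+1)^2+4qk}}{2},$$ $$V(n,k,p,a)=a+\frac{p(n-k+a+1)}{pn+p-k+a},\qquad U(n,k,p)=\min_{a\in\mathbb{N}_0}V(n,k,p,a).$$ The odds ratio is $r=\dfrac{fq}{(1-f)p}$. *)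

theory Defs
  imports Complex_Main
begin

definition binom_prob :: "nat \<Rightarrow> nat \<Rightarrow> real \<Rightarrow> real" where
  "binom_prob n k p = real (n choose k) * p ^ k * (1 - p) ^ (n - k)"

definition binom_cdf :: "nat \<Rightarrow> nat \<Rightarrow> real \<Rightarrow> real" where
  "binom_cdf n k p = (\<Sum>j = 0..k. binom_prob n j p)"

definition L_bound :: "nat \<Rightarrow> nat \<Rightarrow> real \<Rightarrow> real" where
  "L_bound n k p =
     (real k + 1 - p * real n + sqrt ((p * real n - real k + 1)\<^sup>2 + 4 * (1 - p) * real k)) / 2"

definition V_bound :: "nat \<Rightarrow> nat \<Rightarrow> real \<Rightarrow> real \<Rightarrow> real" where
  "V_bound n k p a =
     a + p * (real n - real k + a + 1) / (p * real n + p - real k + a)"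

text \<open>
  The minimum over the nonnegative integers, as the least element of the set of values.
  For \<open>0 < p\<close> and \<open>k \<le> p n\<close> it exists, since every denominator is positive and
  hence \<open>V_bound n k p a \<ge> a\<close> whenever \<open>k \<le> n\<close>.
\<close>

definition U_bound :: "nat \<Rightarrow> nat \<Rightarrow> real \<Rightarrow> real" where
  "U_bound n k p = (LEAST u. \<exists>a::nat. u = V_bound n k p (real a))"

definition odds_ratio :: "real \<Rightarrow> real \<Rightarrow> real" where
  "odds_ratio f p = f * (1 - p) / ((1 - f) * p)"

end

(* Put R k = B k / b k, so that R (k + 1) = 1 + t * R k with t = (k + 1) q / (p (n - k)).  Since
   L k is the root >= 1 of (x - 1) (x + p n - k) = q k, the lower bound follows by induction from
   1 + t * L k > L (k + 1).  The upper bounds R k < V k a follow by a simultaneous induction over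
   all natural a, stepping from (k, a) to (k + 1, a + 1) and from (k, 0) to (k + 1, 0).  Finally
   V k (L - 1) = 2 L - 1, and rounding L - 1 up to an integer increases V by less than 1. *)
theory Submission
  imports Defs
begin

section \<open>Consecutive binomial weights and the recursion for the ratio\<close>

lemma binom_prob_pos:
  assumes "k \<le> n" "0 < p" "p < 1"
  shows "0 < binom_prob n k p"
  using assms by (simp add: binom_prob_def)

lemma binom_prob_Suc:
  assumes "Suc k \<le> n"
  shows "binom_prob n (Suc k) p * (real (Suc k) * (1 - p)) = binom_prob n k p * (p * (real n - real k))"
proof -
  \<comment> \<open>This removes truncated subtraction: after multiplication both sides carry the
    powers \<open>p ^ Suc k\<close> and \<open>(1 - p) ^ Suc d\<close>.\<close>
  obtain d where n: "n = Suc (k + d)"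
    using assms less_iff_Suc_add by (metis Suc_le_lessD)
  have "Suc k * (n choose Suc k) = (n - k) * (n choose k)"
    by (simp only: binomial_absorption binomial_absorb_comp)
  then have "real (Suc k * (n choose Suc k)) = real ((n - k) * (n choose k))"
    by (rule arg_cong)
  then have "(real (n choose Suc k) * real (Suc k)) * (p ^ Suc k * (1 - p) ^ Suc d)
      = (real (n choose k) * (real n - real k)) * (p ^ Suc k * (1 - p) ^ Suc d)"
    using assms by (simp only: of_nat_mult of_nat_diff[of k n]) (simp add: mult.commute)
  then show ?thesis
    by (simp add: binom_prob_def n mult_ac del: of_nat_Suc binomial_Suc_Suc)
qed

lemma ratio_0:
  assumes "p < 1"
  shows "binom_cdf n 0 p / binom_prob n 0 p = 1"
  using assms by (simp add: binom_cdf_def binom_prob_def)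

lemma ratio_Suc:
  assumes "Suc k \<le> n" "0 < p" "p < 1"
  shows "binom_cdf n (Suc k) p / binom_prob n (Suc k) p =
    1 + real (Suc k) * (1 - p) / (p * (real n - real k)) * (binom_cdf n k p / binom_prob n k p)"
proof -
  have pos: "binom_prob n k p > 0" "binom_prob n (Suc k) p > 0"
    using assms by (auto intro: binom_prob_pos)
  have m: "p * (real n - real k) > 0"
    using assms by simp
  \<comment> \<open>The coefficient is the quotient of neighbouring weights, so the recursion is
    just the last summand split off and divided through.\<close>
  have t: "real (Suc k) * (1 - p) / (p * (real n - real k)) = binom_prob n k p / binom_prob n (Suc k) p"
    by (subst frac_eq_eq) (use binom_prob_Suc[OF assms(1), of p] pos m in \<open>auto simp: mult.commute\<close>)
  have c: "binom_cdf n (Suc k) p = binom_cdf n k p + binom_prob n (Suc k) p"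
    by (simp add: binom_cdf_def)
  show ?thesis
    unfolding t c using pos by (simp add: field_simps)
qed

section \<open>The lower bound\<close>

lemma L_bound_ge_1:
  assumes "p \<le> 1" "real k \<le> p * real n"
  shows "1 \<le> L_bound n k p"
proof -
  have "p * real n - real k + 1 \<le> sqrt ((p * real n - real k + 1)\<^sup>2 + 4 * (1 - p) * real k)"
    using assms by (intro real_le_rsqrt) simp
  then show ?thesis
    by (simp add: L_bound_def)
qed

lemma L_bound_root:
  assumes "p \<le> 1"
  shows "(L_bound n k p - 1) * (L_bound n k p + p * real n - real k) = (1 - p) * real k"
proof -
  define S where "S = sqrt ((p * real n - real k + 1)\<^sup>2 + 4 * (1 - p) * real k)"
  have S: "S\<^sup>2 = (p * real n - real k + 1)\<^sup>2 + 4 * (1 - p) * real k"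
    using assms by (simp add: S_def)
  have L: "L_bound n k p = (real k + 1 - p * real n + S) / 2"
    by (simp add: L_bound_def S_def)
  \<comment> \<open>With d = p n - k the doubled factors are S - (d + 1) and S + (d + 1), so the
    product is a difference of squares.\<close>
  have "4 * ((L_bound n k p - 1) * (L_bound n k p + p * real n - real k))
      = S\<^sup>2 - (p * real n - real k + 1)\<^sup>2"
    unfolding L by (simp add: field_simps power2_eq_square)
  then show ?thesis
    using S by simp argo
qed

text \<open>For x \<ge> 1 both factors of the quadratic are nonnegative and increasing, so its value
  at x can be compared with its value at the root. This avoids estimating square roots.\<close>

lemma L_bound_less:
  assumes "p \<le> 1" "real k \<le> p * real n" "1 \<le> x"
    and "(1 - p) * real k < (x - 1) * (x + p * real n - real k)"
  shows "L_bound n k p < x"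
proof (rule ccontr)
  assume "\<not> L_bound n k p < x"
  then have "(x - 1) * (x + p * real n - real k)
      \<le> (L_bound n k p - 1) * (L_bound n k p + p * real n - real k)"
    using assms by (intro mult_mono) auto
  with assms L_bound_root[of p n k] show False
    by simp
qed

lemma L_bound_gt_1:
  assumes "p < 1" "real k \<le> p * real n" "1 \<le> k"
  shows "1 < L_bound n k p"
  using L_bound_ge_1[of p k n] L_bound_root[of p n k] assms
  by (cases "L_bound n k p = 1") auto

text \<open>The right-hand side simplifies to 1 + Q / X, which is then tested in the quadratic
  belonging to k + 1 by means of \<open>L_bound_less\<close>.\<close>

lemma L_bound_Suc_less:
  assumes "0 < p" "p < 1" "real (Suc k) \<le> p * real n"
  shows "L_bound n (Suc k) p
    < 1 + real (Suc k) * (1 - p) / (p * (real n - real k)) * L_bound n k p"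
proof -
  define l where "l = L_bound n k p"
  define X where "X = l + p * real n - real k - 1"
  define m where "m = p * (real n - real k)"
  define Q where "Q = (1 - p) * real (Suc k)"
  have Q: "Q > 0"
    using assms by (simp add: Q_def)
  have l1: "1 \<le> l"
    using assms by (simp add: l_def L_bound_ge_1)
  then have X: "X > 0"
    using assms by (auto simp: X_def)
  have root: "(l - 1) * (X + 1) = (1 - p) * real k"
    using L_bound_root[of p n k] assms by (simp add: l_def X_def)
  \<comment> \<open>The root equation factors p (n - k), so l cancels from the product of
    coefficient and bound.\<close>
  then have m: "m = l * X"
    by (simp add: m_def X_def algebra_simps)
  have t: "Q / m * l = Q / X"
    using l1 X by (simp add: m)
  have "(l - 1) * X < Q"
  proof -
    have "(l - 1) * X \<le> (l - 1) * (X + 1)"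
      using l1 by (intro mult_left_mono) auto
    also have "\<dots> < Q"
      using assms by (simp add: root Q_def)
    finally show ?thesis .
  qed
  then have "l - 1 < Q / X"
    using X by (simp add: pos_less_divide_eq)
  \<comment> \<open>Since X - l + 1 = p n - k, the right side is the quadratic for k + 1 at 1 + Q /
    X; the left side is Q.\<close>
  then have "Q / X * X < Q / X * (Q / X + X - l + 1)"
    using X Q by (intro mult_strict_left_mono) auto
  then have "Q < Q / X * (Q / X + X - l + 1)"
    using X by simp
  then have "L_bound n (Suc k) p < 1 + Q / X"
    using assms X Q by (intro L_bound_less) (auto simp: Q_def X_def algebra_simps)
  then show ?thesis
    by (metis t Q_def m_def l_def mult.commute)
qed

lemma L_bound_le_ratio:
  assumes "0 < p" "p < 1" "real k \<le> p * real n"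
  shows "L_bound n k p \<le> binom_cdf n k p / binom_prob n k p
    \<and> (1 \<le> k \<longrightarrow> L_bound n k p < binom_cdf n k p / binom_prob n k p)"
  using assms(3)
proof (induction k)
  case 0
  have "L_bound n 0 p = 1"
    using assms by (simp add: L_bound_def)
  with assms show ?case
    by (simp add: ratio_0)
next
  case (Suc k)
  have "p * real n \<le> real n"
    using assms by (simp add: mult_left_le_one_le)
  with Suc.prems have kn: "Suc k \<le> n"
    by linarith
  have "L_bound n k p \<le> binom_cdf n k p / binom_prob n k p"
    using Suc by simp
  then have "real (Suc k) * (1 - p) / (p * (real n - real k)) * L_bound n k p
      \<le> real (Suc k) * (1 - p) / (p * (real n - real k)) * (binom_cdf n k p / binom_prob n k p)"
    using assms kn by (intro mult_left_mono) auto
  with L_bound_Suc_less[of p k n] ratio_Suc[OF kn, of p] Suc.prems assms show ?case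
    by linarith
qed

section \<open>The family of upper bounds\<close>

lemma V_bound_ge:
  assumes "0 < p" "k \<le> n" "real k \<le> p * real n" "0 \<le> a"
  shows "a \<le> V_bound n k p a"
  using assms by (simp add: V_bound_def)

text \<open>Since p N = D + Q, the right side is 1 + Q / D, and the left side is 1 + Q (N + 1) / (N
  (D + 1)). The claim thus reduces to D < N.\<close>

lemma V_bound_Suc_0:
  assumes "0 < p" "p < 1" "real (Suc k) \<le> p * real n" "Suc k \<le> n"
  shows "1 + real (Suc k) * (1 - p) / (p * (real n - real k)) * V_bound n k p 0
    < V_bound n (Suc k) p 0"
proof -
  define N where "N = real n - real k"
  define D where "D = p * real n + p - real (Suc k)"
  define Q where "Q = real (Suc k) * (1 - p)"
  have pos: "N > 0" "D > 0" "Q > 0"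
    using assms by (auto simp: N_def D_def Q_def)
  have DN: "D < N"
  proof -
    have "p * (real n + 1) < 1 * (real n + 1)"
      using assms by (intro mult_strict_right_mono) auto
    then show ?thesis
      by (simp add: D_def N_def algebra_simps)
  qed
  have V0: "V_bound n k p 0 = p * (N + 1) / (D + 1)"
    by (simp add: V_bound_def N_def D_def algebra_simps)
  have V1: "V_bound n (Suc k) p 0 = p * N / D"
    by (simp add: V_bound_def N_def D_def algebra_simps)
  have pN: "p * N = D + Q"
    by (simp add: D_def N_def Q_def algebra_simps)
  have "1 + Q / (p * N) * V_bound n k p 0 = 1 + Q * ((N + 1) / (N * (D + 1)))"
    using assms pos by (simp add: V0)
  also have "\<dots> < 1 + Q * (1 / D)"
  proof -
    have "(N + 1) / (N * (D + 1)) < 1 / D"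
      using pos DN by (simp add: divide_simps) (simp add: algebra_simps)
    then show ?thesis
      using pos by (intro add_strict_left_mono mult_strict_left_mono) auto
  qed
  also have "\<dots> = V_bound n (Suc k) p 0"
    unfolding V1 pN using pos by (simp add: field_simps)
  finally show ?thesis
    by (simp add: N_def Q_def)
qed

text \<open>The fraction in V depends on k and a only through a - k, so raising both adds exactly 1
  to V. The coefficient on the left is below 1 because k + 1 < p (n + 1).\<close>

lemma V_bound_Suc_Suc:
  assumes "0 < p" "p < 1" "real (Suc k) \<le> p * real n" "Suc k \<le> n" "0 \<le> a"
  shows "1 + real (Suc k) * (1 - p) / (p * (real n - real k)) * V_bound n k p a
    < V_bound n (Suc k) p (a + 1)"
proof -
  have eq: "V_bound n (Suc k) p (a + 1) = 1 + V_bound n k p a"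
    by (simp add: V_bound_def algebra_simps)
  have V: "V_bound n k p a > 0"
    unfolding V_bound_def
    by (rule add_nonneg_pos, use assms in simp) (intro divide_pos_pos mult_pos_pos, use assms in auto)
  have "real (Suc k) * (1 - p) < p * (real n - real k)"
    using assms by (simp add: algebra_simps)
  then have "real (Suc k) * (1 - p) / (p * (real n - real k)) < 1"
    using assms by simp
  then show ?thesis
    unfolding eq using V mult_strict_right_mono[of _ 1] by fastforce
qed

lemma ratio_le_V_bound:
  assumes "0 < p" "p < 1" "real k \<le> p * real n"
  shows "binom_cdf n k p / binom_prob n k p \<le> V_bound n k p (real a)
    \<and> (1 \<le> k \<longrightarrow> binom_cdf n k p / binom_prob n k p < V_bound n k p (real a))"
  using assms(3)
proof (induction k arbitrary: a)
  case 0
  have "1 \<le> V_bound n 0 p (real a)"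
  proof (cases "a = 0")
    case True
    \<comment> \<open>Here the bound is attained, so strictness can only start at k = 1.\<close>
    have "p * (real n + 1) > 0"
      using assms by simp
    then have "V_bound n 0 p 0 = 1"
      by (simp add: V_bound_def algebra_simps)
    with True show ?thesis
      by simp
  next
    case False
    then show ?thesis
      using V_bound_ge[of p 0 n "real a"] assms by simp
  qed
  with assms show ?case
    by (simp add: ratio_0)
next
  case (Suc k)
  have "p * real n \<le> real n"
    using assms by (simp add: mult_left_le_one_le)
  with Suc.prems have kn: "Suc k \<le> n"
    by linarith
  define t where "t = real (Suc k) * (1 - p) / (p * (real n - real k))"
  have t: "0 \<le> t"
    using assms kn by (simp add: t_def)
  have step: "1 + t * (binom_cdf n k p / binom_prob n k p) \<le> 1 + t * V_bound n k p (real b)" for b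
    using Suc.IH[of b] Suc.prems t by (intro add_left_mono mult_left_mono) auto
  have "1 + t * (binom_cdf n k p / binom_prob n k p) < V_bound n (Suc k) p (real a)"
  proof (cases a)
    case 0
    show ?thesis
      using step[of 0] V_bound_Suc_0[OF assms(1,2) Suc.prems kn] by (simp add: 0 t_def)
  next
    case (Suc b)
    show ?thesis
      using step[of b] V_bound_Suc_Suc[OF assms(1,2) Suc.prems kn, of "real b"]
      by (simp add: Suc t_def add.commute)
  qed
  then show ?case
    using ratio_Suc[OF kn assms(1,2)] by (simp add: t_def)
qed

section \<open>The minimum over a and its comparison with the lower bound\<close>

lemma U_bound_attained:
  assumes "0 < p" "k \<le> n" "real k \<le> p * real n"
  shows "(\<exists>a. U_bound n k p = V_bound n k p (real a))
    \<and> (\<forall>a. U_bound n k p \<le> V_bound n k p (real a))"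
proof -
  define W where "W a = V_bound n k p (real a)" for a :: nat
  have W: "real a \<le> W a" for a
    using V_bound_ge assms by (simp add: W_def)
  \<comment> \<open>As V is at least a, every a > M gives a value above the one at 0. The minimum
    over a \<le> M is therefore global, which justifies \<open>LEAST\<close> on the reals.\<close>
  obtain M where M: "W 0 \<le> real M"
    using real_arch_simple by blast
  have fin: "finite (W ` {..M})" "W ` {..M} \<noteq> {}"
    by auto
  have min: "Min (W ` {..M}) \<le> W a" for a
  proof (cases "a \<le> M")
    case True
    then show ?thesis
      by simp
  next
    case False
    have "Min (W ` {..M}) \<le> W 0"
      by simp
    with False M W[of a] show ?thesis
      by linarith
  qed
  have att: "\<exists>a. Min (W ` {..M}) = W a"
    using Min_in[OF fin] by blast
  have "U_bound n k p = Min (W ` {..M})"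
    unfolding U_bound_def
  proof (rule Least_equality)
    show "\<exists>a::nat. Min (W ` {..M}) = V_bound n k p (real a)"
      using att by (simp add: W_def)
  next
    fix y
    assume "\<exists>a::nat. y = V_bound n k p (real a)"
    then show "Min (W ` {..M}) \<le> y"
      using min by (auto simp: W_def)
  qed
  with att min show ?thesis
    by (simp add: W_def)
qed

lemma V_bound_less_2_L_bound:
  assumes "0 < p" "p < 1" "real k \<le> p * real n"
  shows "\<exists>a::nat. V_bound n k p (real a) < 2 * L_bound n k p"
proof -
  define l where "l = L_bound n k p"
  have l1: "1 \<le> l"
    using assms by (simp add: l_def L_bound_ge_1)
  \<comment> \<open>At the real point l - 1 the value of V is 2 l - 1; \<theta> is the rounding
    error.\<close>
  define a where "a = nat \<lceil>l - 1\<rceil>"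
  define \<theta> where "\<theta> = real a - (l - 1)"
  have th: "0 \<le> \<theta>" "\<theta> < 1"
    using l1 by (auto simp: a_def \<theta>_def) linarith+
  define X where "X = l + p * real n - real k - 1 + p"
  have X: "X > 0"
    using assms l1 by (simp add: X_def)
  have "(l - 1) * (l + p * real n - real k) = (1 - p) * real k"
    using L_bound_root[of p n k] assms by (simp add: l_def)
  then have num: "p * (real n - real k + real a + 1) = l * X + p * \<theta>"
    by (simp add: X_def \<theta>_def algebra_simps)
  have den: "p * real n + p - real k + real a = X + \<theta>"
    by (simp add: X_def \<theta>_def)
  \<comment> \<open>The fraction is a weighted mean of l and p with weights X and \<theta>, hence at
    most l.\<close>
  have "p * \<theta> \<le> l * \<theta>"
    using assms l1 th by (intro mult_right_mono) auto
  then have "(l * X + p * \<theta>) / (X + \<theta>) \<le> l"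
    using X th by (simp add: pos_divide_le_eq algebra_simps)
  then have "V_bound n k p (real a) \<le> real a + l"
    unfolding V_bound_def num den by simp
  also have "\<dots> < 2 * l"
    using th by (simp add: \<theta>_def)
  finally show ?thesis
    unfolding l_def by blast
qed

theorem theorem2p1:
  fixes n k :: nat and p f r :: real
  assumes "n \<ge> 1"
    and "0 < p" and "p < 1"
    and "real k \<le> p * real n"
    and "f = real k / real n"
    and "r = odds_ratio f p"
  shows "(1 \<le> L_bound n k p
          \<and> L_bound n k p \<le> binom_cdf n k p / binom_prob n k p
          \<and> binom_cdf n k p / binom_prob n k p \<le> U_bound n k p
          \<and> U_bound n k p < 2 * L_bound n k p)
       \<and> (k \<ge> 1 \<longrightarrow>
            1 < L_bound n k p
          \<and> L_bound n k p < binom_cdf n k p / binom_prob n k p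
          \<and> binom_cdf n k p / binom_prob n k p < U_bound n k p
          \<and> U_bound n k p < 2 * L_bound n k p)
       \<and> (0 < f \<and> f < p \<longrightarrow>
            1 < L_bound n k p
          \<and> L_bound n k p < binom_cdf n k p / binom_prob n k p
          \<and> binom_cdf n k p / binom_prob n k p < U_bound n k p
          \<and> U_bound n k p \<le> V_bound n k p 0
          \<and> V_bound n k p 0 < (1 - f) * p / (p - f)
          \<and> (1 - f) * p / (p - f) = 1 / (1 - r))"
proof -
  note p = assms(2,3) and kpn = assms(4)
  have "p * real n < real n"
    using assms(1) p by simp
  with kpn have kn: "k < n"
    by linarith
  note U = U_bound_attained[OF p(1) less_imp_le[OF kn] kpn]
  note R = ratio_le_V_bound[OF p kpn]
  note L = L_bound_le_ratio[OF p kpn]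
  have U2: "U_bound n k p < 2 * L_bound n k p"
    using V_bound_less_2_L_bound[OF p kpn] U le_less_trans by blast
  have RU: "binom_cdf n k p / binom_prob n k p \<le> U_bound n k p"
    using U R by metis
  have RU': "binom_cdf n k p / binom_prob n k p < U_bound n k p" if "1 \<le> k"
    using U R that by metis
  have L1: "1 \<le> L_bound n k p"
    using L_bound_ge_1 p kpn by simp
  have L1': "1 < L_bound n k p" if "1 \<le> k"
    using L_bound_gt_1 p kpn that by simp
  have UV: "U_bound n k p \<le> V_bound n k p 0"
    using U by (metis of_nat_0)
  have f_pos: "1 \<le> k" if "0 < f"
    using that assms(5) by (cases k) auto
  have last: "V_bound n k p 0 < (1 - f) * p / (p - f) \<and> (1 - f) * p / (p - f) = 1 / (1 - r)"
    if f: "0 < f" "f < p"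
  proof
    have n: "real n > 0"
      using assms(1) by simp
    have k: "real k = f * real n"
      using n assms(5) by simp
    define s where "s = p * real n - real k"
    define N where "N = real n - real k"
    have s: "s > 0"
      using f n by (simp add: s_def k)
    have lt: "s < p * N"
      using f_pos f p by (simp add: s_def N_def algebra_simps)
    \<comment> \<open>The left side is the mediant of p N / s > 1 and p / p = 1, so it lies strictly
      below p N / s.\<close>
    have "p * (N + 1) / (s + p) < p * N / s"
    proof -
      have "p * s < p * (p * N)"
        using lt p by simp
      then show ?thesis
        using s p by (simp add: divide_simps) (simp add: algebra_simps)
    qed
    moreover have "V_bound n k p 0 = p * (N + 1) / (s + p)"
      by (simp add: V_bound_def s_def N_def algebra_simps)
    moreover have "p * N / s = (1 - f) * p / (p - f)"
    proof -
      have e: "p * N = ((1 - f) * p) * real n" "s = (p - f) * real n"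
        by (simp_all add: N_def s_def k algebra_simps)
      show ?thesis
        unfolding e using n by simp
    qed
    ultimately show "V_bound n k p 0 < (1 - f) * p / (p - f)"
      by simp
    have nz: "(1 - f) * p \<noteq> 0"
      using f p by simp
    \<comment> \<open>The numerator is (1 - f) p - f (1 - p) = p - f.\<close>
    have "1 - r = (p - f) / ((1 - f) * p)"
      using nz by (simp add: assms(6) odds_ratio_def field_simps)
    then show "(1 - f) * p / (p - f) = 1 / (1 - r)"
      by simp
  qed
  show ?thesis
    using L L1 L1' RU RU' U2 UV f_pos last by blast
qed

end
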